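(* Let $S$ be a symmetric numerical semigroup. Then $$f\left(\frac{S}{2}\right)=\frac{f(S)-x}{2},$$ where $x$ is the smallest odd generator of $S$.
   Context: $\mathbb{N}$ denotes the set of nonnegative integers. A numerical semigroup is a submonoid $S$ of $(\mathbb{N},+)$ (so $0\in S$) such that $\mathbb{N}\setminus S$ is finite. The Frobenius number $f(S)$ is the largest integer not belonging to $S$ (so $f(\mathbb{N})=-1$). The quotient is the numerical semigroup $\frac{S}{2}=\{s\in\mathbb{N}\mid 2s\in S\}$. The type of $S$ is the number of integers $y\in\mathbb{Z}\setminus S$ such that $y+s\in S$ for all $s\in S\setminus\{0\}$; $S$ is symmetric if it has type one. A generator of $S$ means an element of its unique minimal system of generators, where $a_1,\dots,a_e$ is a system of generators of $S$ if $S=\{\lambda_1a_1+\dots+\lambda_ea_e\mid \lambda_1,\dots,\lambda_e\in\mathbb{N}\}$. *)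

theory Defs
  imports Complex_Main
begin

definition numerical_semigroup :: "nat set \<Rightarrow> bool" where
  "numerical_semigroup S \<longleftrightarrow>
     0 \<in> S \<and> (\<forall>a\<in>S. \<forall>b\<in>S. a + b \<in> S) \<and> finite (UNIV - S)"

text \<open>The maximum is taken over all integers, so that the Frobenius number of the semigroup
  of all natural numbers is \<open>-1\<close>.\<close>

definition frobenius_number :: "nat set \<Rightarrow> int" where
  "frobenius_number S = (GREATEST z::int. z \<notin> int ` S)"

definition semigroup_quotient :: "nat set \<Rightarrow> nat \<Rightarrow> nat set" where
  "semigroup_quotient S d = {s. d * s \<in> S}"

definition semigroup_type :: "nat set \<Rightarrow> nat" where
  "semigroup_type S =
     card {y::int. y \<notin> int ` S \<and> (\<forall>s\<in>S - {0}. y + int s \<in> int ` S)}"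

definition symmetric_semigroup :: "nat set \<Rightarrow> bool" where
  "symmetric_semigroup S \<longleftrightarrow> semigroup_type S = 1"

definition system_of_generators :: "nat set \<Rightarrow> nat set \<Rightarrow> bool" where
  "system_of_generators A S \<longleftrightarrow>
     finite A \<and> S = {(\<Sum>a\<in>A. c a * a) | c :: nat \<Rightarrow> nat. True}"

definition minimal_system_of_generators :: "nat set \<Rightarrow> nat set \<Rightarrow> bool" where
  "minimal_system_of_generators A S \<longleftrightarrow>
     system_of_generators A S \<and> (\<forall>B. B \<subset> A \<longrightarrow> \<not> system_of_generators B S)"

text \<open>A numerical semigroup has exactly one minimal system of generators, so the description
  below denotes it; for other sets nothing is claimed.\<close>

definition generators :: "nat set \<Rightarrow> nat set" where
  "generators S = (THE A. minimal_system_of_generators A S)"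

end

theory Submission imports Defs begin

text \<open>
  A gap is an integer outside \<open>S\<close>; write \<open>F\<close> for the largest gap, the Frobenius number. It is one
  of the integers counted by the type. Moreover, every gap \<open>z\<close> leads to such an integer of the form
  \<open>z + s\<close> with \<open>s \<in> S\<close>, namely the largest gap of that form (\<open>gap_below_pseudo_frobenius\<close>). If the
  type is one, this integer must be \<open>F\<close>, so \<open>F - z \<in> S\<close>. Hence a symmetric semigroup satisfies the
  reflection law: \<open>z \<notin> S\<close> if and only if \<open>F - z \<in> S\<close>, for all integers \<open>z\<close>
  (\<open>symmetric_reflection\<close>). In particular \<open>F\<close> is odd, since otherwise \<open>z = F / 2\<close> would violate the
  law.

  The gaps of \<open>S / 2\<close> are the integers \<open>z\<close> with \<open>2 z \<notin> S\<close>, that is, those for which the odd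
  integer \<open>F - 2 z\<close> belongs to \<open>S\<close>. Making \<open>z\<close> as large as possible makes this odd element as
  small as possible, so the largest gap of \<open>S / 2\<close> is \<open>(F - x) / 2\<close> where \<open>x\<close> is the smallest odd
  element of \<open>S\<close>.

  It remains to see that \<open>x\<close> is the smallest odd generator. The minimal system of generators
  consists of the nonzero elements that are not sums of two nonzero elements of \<open>S\<close>
  (\<open>generators_eq_atoms\<close>), and \<open>x\<close> is of this kind because one of the two summands would be a
  smaller odd element.
\<close>

section \<open>The minimal system of generators\<close>

definition atoms :: "nat set \<Rightarrow> nat set" where
  "atoms S = {s\<in>S - {0}. \<forall>a\<in>S - {0}. \<forall>b\<in>S - {0}. s \<noteq> a + b}"

lemma atom_decomp:
  assumes "s \<in> atoms S" "s = a + b" "a \<in> S" "b \<in> S"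
  shows "a = 0 \<or> b = 0"
  using assms unfolding atoms_def by blast

lemma sum_mem_semigroup:
  fixes c :: "nat \<Rightarrow> nat"
  assumes S: "numerical_semigroup S" and "A \<subseteq> S"
  shows "(\<Sum>a\<in>A. c a * a) \<in> S"
proof -
  have add: "a + b \<in> S" if "a \<in> S" "b \<in> S" for a b
    using S that unfolding numerical_semigroup_def by blast
  have zero: "0 \<in> S"
    using S unfolding numerical_semigroup_def by blast
  have mult: "k * a \<in> S" if "a \<in> S" for k a :: nat
    by (induction k) (auto simp: zero add that)
  show ?thesis
    using \<open>A \<subseteq> S\<close> by (induction A rule: infinite_finite_induct) (auto simp: zero add mult)
qed

text \<open>In a combination of generators, one generator can be split off; the remainder is again such a
  combination, so for an atom the remainder must vanish.\<close>

lemma atoms_subset_generating: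
  assumes gen: "system_of_generators A S"
  shows "atoms S \<subseteq> A"
proof
  fix s assume s: "s \<in> atoms S"
  have fin: "finite A" and span: "S = {(\<Sum>a\<in>A. c a * a) | c :: nat \<Rightarrow> nat. True}"
    using gen unfolding system_of_generators_def by auto
  have span_mem: "(\<Sum>a\<in>A. c a * a) \<in> S" for c :: "nat \<Rightarrow> nat"
    by (subst span) (rule CollectI, rule exI[of _ c], simp)
  have "s \<in> S" "s \<noteq> 0"
    using s unfolding atoms_def by auto
  from \<open>s \<in> S\<close> obtain c :: "nat \<Rightarrow> nat" where c: "s = (\<Sum>a\<in>A. c a * a)"
    by (subst (asm) span) (elim CollectE exE conjE)
  then have "\<exists>a\<in>A. c a * a \<noteq> 0"
    using \<open>s \<noteq> 0\<close> sum.neutral[of A "\<lambda>a. c a * a"] by metis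
  then obtain a where a: "a \<in> A" "c a * a \<noteq> 0"
    by blast
  define rest where "rest = (\<Sum>b\<in>A. (c(a := c a - 1)) b * b)"
  have "rest \<in> S"
    unfolding rest_def by (rule span_mem)
  have "(\<Sum>b\<in>A. (if b = a then 1 else 0) * b) = (\<Sum>b\<in>A. if b = a then b else 0)"
    by (rule sum.cong) auto
  also have "\<dots> = a"
    using fin a(1) by simp
  finally have "a \<in> S"
    using span_mem[of "\<lambda>b. if b = a then 1 else 0"] by (simp only:)
  have "s = c a * a + (\<Sum>b\<in>A - {a}. c b * b)"
    unfolding c by (rule sum.remove[OF fin a(1)])
  moreover have "(\<Sum>b\<in>A - {a}. (c(a := c a - 1)) b * b) = (\<Sum>b\<in>A - {a}. c b * b)"
    by (rule sum.cong) auto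
  then have "rest = (c a - 1) * a + (\<Sum>b\<in>A - {a}. c b * b)"
    unfolding rest_def by (subst sum.remove[OF fin a(1)]) (simp only: fun_upd_same)
  moreover have "c a * a = a + (c a - 1) * a"
    using a(2) by (cases "c a") auto
  ultimately have split: "s = a + rest"
    by linarith
  then have "rest = 0"
    using atom_decomp[OF s split \<open>a \<in> S\<close> \<open>rest \<in> S\<close>] a(2) by (metis mult_0_right)
  then show "s \<in> A"
    using split a(1) by simp
qed

lemma finite_atoms:
  assumes S: "numerical_semigroup S"
  shows "finite (atoms S)"
proof -
  have "finite (UNIV - S)"
    using S unfolding numerical_semigroup_def by blast
  then obtain n where n: "\<And>k. k \<notin> S \<Longrightarrow> k < n"
    by (metis Diff_iff UNIV_I finite_nat_set_iff_bounded)
  \<comment> \<open>Everything from the positive number \<open>n + 1\<close> on lies in \<open>S\<close>, so from \<open>2 (n + 1)\<close> on one may split off \<open>n + 1\<close>.\<close>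
  have "s < 2 * (n + 1)" if "s \<in> atoms S" for s
  proof (rule ccontr)
    assume "\<not> s < 2 * (n + 1)"
    then have "s = (n + 1) + (s - (n + 1))" "n + 1 \<in> S" "s - (n + 1) \<in> S" "s - (n + 1) \<noteq> 0"
      using n by (auto, fastforce+)
    then show False
      using atom_decomp[OF that] by (metis add_is_0 one_neq_zero)
  qed
  then show ?thesis
    by (meson finite_nat_set_iff_bounded)
qed

lemma atoms_generate:
  assumes S: "numerical_semigroup S"
  shows "system_of_generators (atoms S) S"
proof -
  have fin: "finite (atoms S)"
    using S by (rule finite_atoms)
  have sub: "atoms S \<subseteq> S"
    unfolding atoms_def by auto
  have "\<exists>c :: nat \<Rightarrow> nat. s = (\<Sum>a\<in>atoms S. c a * a)" if "s \<in> S" for s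
    using that
  proof (induction s rule: less_induct)
    case (less s)
    consider "s = 0" | "s \<in> atoms S" | a b where "a \<in> S - {0}" "b \<in> S - {0}" "s = a + b"
      using less.prems unfolding atoms_def by blast
    then show ?case
    proof cases
      case 1
      then show ?thesis
        by (intro exI[of _ "\<lambda>_. 0"]) simp
    next
      case 2
      then show ?thesis
        using fin by (intro exI[of _ "\<lambda>a. if a = s then 1 else 0"])
          (simp add: if_distrib[of "\<lambda>x. x * _"] sum.delta cong: if_cong)
    next
      case 3
      obtain c d :: "nat \<Rightarrow> nat"
        where "a = (\<Sum>x\<in>atoms S. c x * x)" "b = (\<Sum>x\<in>atoms S. d x * x)"
        using less.IH[of a] less.IH[of b] 3 by auto
      then have "s = (\<Sum>x\<in>atoms S. (c x + d x) * x)"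
        using 3 by (simp add: distrib_right sum.distrib)
      then show ?thesis
        by (intro exI[of _ "\<lambda>x. c x + d x"])
    qed
  qed
  then show ?thesis
    unfolding system_of_generators_def
    using fin sum_mem_semigroup[OF S sub] by blast
qed

lemma generators_eq_atoms:
  assumes S: "numerical_semigroup S"
  shows "generators S = atoms S"
  unfolding generators_def
proof (rule the_equality)
  show "minimal_system_of_generators (atoms S) S"
    unfolding minimal_system_of_generators_def
    using atoms_generate[OF S] atoms_subset_generating by blast
next
  fix A assume "minimal_system_of_generators A S"
  then have "system_of_generators A S" and "\<not> atoms S \<subset> A"
    using atoms_generate[OF S] unfolding minimal_system_of_generators_def by auto
  moreover from this(1) have "atoms S \<subseteq> A"
    by (rule atoms_subset_generating)
  ultimately show "A = atoms S"
    by auto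
qed

text \<open>A decomposition of an odd number has a smaller odd summand, so the smallest odd element cannot
  be decomposed.\<close>

lemma least_odd_generator:
  assumes S: "numerical_semigroup S"
  shows "(LEAST x. x \<in> generators S \<and> odd x) = (LEAST x. x \<in> S \<and> odd x)"
proof (rule Least_equality)
  have "finite (UNIV - S)"
    using S unfolding numerical_semigroup_def by blast
  then obtain n where n: "\<And>k. k \<notin> S \<Longrightarrow> k < n"
    by (metis Diff_iff UNIV_I finite_nat_set_iff_bounded)
  have ex: "2 * n + 1 \<in> S \<and> odd (2 * n + 1)"
    using n[of "2 * n + 1"] by auto
  define m where "m = (LEAST x. x \<in> S \<and> odd x)"
  have m: "m \<in> S" "odd m"
    unfolding m_def using LeastI[of "\<lambda>x. x \<in> S \<and> odd x", OF ex] by auto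
  have least: "m \<le> a" if "a \<in> S" "odd a" for a
    unfolding m_def using that by (intro Least_le) auto
  have "m \<noteq> a + b" if "a \<in> S - {0}" "b \<in> S - {0}" for a b
  proof
    assume eq: "m = a + b"
    then have "odd a \<or> odd b"
      using m(2) by auto
    then have "m \<le> a \<or> m \<le> b"
      using least that by blast
    then show False
      using eq that by simp
  qed
  moreover have "m \<noteq> 0"
    using m by (intro notI) simp
  ultimately have "m \<in> atoms S"
    using m unfolding atoms_def by simp
  then show "(LEAST x. x \<in> S \<and> odd x) \<in> generators S \<and> odd (LEAST x. x \<in> S \<and> odd x)"
    using m unfolding generators_eq_atoms[OF S] m_def by simp
next
  fix y assume "y \<in> generators S \<and> odd y"
  then show "(LEAST x. x \<in> S \<and> odd x) \<le> y"
    unfolding generators_eq_atoms[OF S] atoms_def by (intro Least_le) blast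
qed

section \<open>Reflection in a symmetric semigroup\<close>

lemma frobenius_number_equality:
  assumes "z \<notin> int ` S" and "\<And>y. y \<notin> int ` S \<Longrightarrow> y \<le> z"
  shows "frobenius_number S = z"
  unfolding frobenius_number_def using assms by (rule Greatest_equality)

lemma frobenius_number_greatest:
  assumes S: "numerical_semigroup S"
  shows "frobenius_number S \<notin> int ` S"
    and "y \<notin> int ` S \<Longrightarrow> y \<le> frobenius_number S"
proof -
  \<comment> \<open>The gap \<open>-1\<close> makes the set nonempty and dominates all negative gaps.\<close>
  define G where "G = insert (-1) (int ` (UNIV - S))"
  have fin: "finite G"
    using S unfolding numerical_semigroup_def G_def by simp
  have "Max G \<in> G"
    using fin by (rule Max_in) (simp add: G_def)
  then have gap: "Max G \<notin> int ` S"
    unfolding G_def by (elim insertE) auto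
  have max: "y \<le> Max G" if "y \<notin> int ` S" for y
  proof (cases "y < 0")
    case True
    moreover have "-1 \<le> Max G"
      using fin by (rule Max_ge) (simp add: G_def)
    ultimately show ?thesis
      by simp
  next
    case False
    then have "y = int (nat y)"
      by simp
    moreover from this have "nat y \<notin> S"
      using that by (metis imageI)
    ultimately have "y \<in> G"
      unfolding G_def by blast
    with fin show ?thesis
      by (rule Max_ge)
  qed
  have frob: "frobenius_number S = Max G"
    using gap max by (rule frobenius_number_equality)
  show "frobenius_number S \<notin> int ` S"
    unfolding frob by (rule gap)
  show "y \<le> frobenius_number S" if "y \<notin> int ` S"
    unfolding frob using that by (rule max)
qed

definition pseudo_frobenius :: "nat set \<Rightarrow> int set" where
  "pseudo_frobenius S = {y. y \<notin> int ` S \<and> (\<forall>s\<in>S - {0}. y + int s \<in> int ` S)}"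

lemma frobenius_number_pseudo_frobenius:
  assumes S: "numerical_semigroup S"
  shows "frobenius_number S \<in> pseudo_frobenius S"
  unfolding pseudo_frobenius_def
  using frobenius_number_greatest[OF S] by fastforce

text \<open>The largest gap of the form \<open>z + s\<close> with \<open>s \<in> S\<close> is pseudo-Frobenius: adding a further nonzero element of \<open>S\<close>
  gives a larger integer of the same form, hence an element of \<open>S\<close>.\<close>

lemma gap_below_pseudo_frobenius:
  assumes S: "numerical_semigroup S" and z: "z \<notin> int ` S"
  obtains s where "s \<in> S" "z + int s \<in> pseudo_frobenius S"
proof -
  let ?P = "\<lambda>s. s \<in> S \<and> z + int s \<notin> int ` S"
  have "0 \<in> S" and add: "\<And>a b. a \<in> S \<Longrightarrow> b \<in> S \<Longrightarrow> a + b \<in> S"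
    using S unfolding numerical_semigroup_def by auto
  then have P0: "?P 0"
    using z by simp
  have "\<forall>s. ?P s \<longrightarrow> s \<le> nat (frobenius_number S - z)"
    using frobenius_number_greatest(2)[OF S] by fastforce
  then obtain s where s: "?P s" and max: "\<And>t. ?P t \<Longrightarrow> t \<le> s"
    using GreatestI_nat[of ?P, OF P0] Greatest_le_nat[of ?P] by blast
  have "(z + int s) + int t \<in> int ` S" if "t \<in> S - {0}" for t
    using max[of "s + t"] add[of s t] s that by (auto simp: add.assoc)
  then show thesis
    using that s unfolding pseudo_frobenius_def by blast
qed

lemma symmetric_reflection:
  assumes S: "numerical_semigroup S" and sym: "symmetric_semigroup S"
  shows "z \<notin> int ` S \<longleftrightarrow> frobenius_number S - z \<in> int ` S"
proof
  let ?F = "frobenius_number S"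
  assume "z \<notin> int ` S"
  then obtain s where s: "s \<in> S" "z + int s \<in> pseudo_frobenius S"
    using gap_below_pseudo_frobenius[OF S] by blast
  have "card (pseudo_frobenius S) = 1"
    using sym unfolding symmetric_semigroup_def semigroup_type_def pseudo_frobenius_def .
  then have "z + int s = ?F"
    using s(2) frobenius_number_pseudo_frobenius[OF S] by (metis card_1_singletonE singletonD)
  then show "?F - z \<in> int ` S"
    using s(1) by (metis add_diff_cancel_left' imageI)
next
  assume *: "frobenius_number S - z \<in> int ` S"
  show "z \<notin> int ` S"
  proof
    assume "z \<in> int ` S"
    with * obtain a b where "a \<in> S" "b \<in> S" "z = int a" "frobenius_number S - z = int b"
      by blast
    then have "a + b \<in> S" "frobenius_number S = int (a + b)"
      using S unfolding numerical_semigroup_def by auto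
    then show False
      using frobenius_number_greatest(1)[OF S] by blast
  qed
qed

lemma symmetric_odd_frobenius_number:
  assumes "numerical_semigroup S" "symmetric_semigroup S"
  shows "odd (frobenius_number S)"
proof
  assume "even (frobenius_number S)"
  then obtain k where "frobenius_number S = 2 * k" ..
  then show False
    using symmetric_reflection[OF assms, of k] by simp
qed

section \<open>The Frobenius number of the half\<close>

lemma int_mem_half_iff: "z \<in> int ` semigroup_quotient S 2 \<longleftrightarrow> 2 * z \<in> int ` S"
proof
  assume "2 * z \<in> int ` S"
  then obtain s where s: "s \<in> S" "2 * z = int s"
    by blast
  then have "z = int (nat z)" "2 * nat z = s"
    by linarith+
  then show "z \<in> int ` semigroup_quotient S 2"
    using s unfolding semigroup_quotient_def by blast
qed (force simp: semigroup_quotient_def image_iff)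

theorem corollary4p6:
  fixes S :: "nat set"
  assumes "numerical_semigroup S"
    and "symmetric_semigroup S"
  shows "real_of_int (frobenius_number (semigroup_quotient S 2)) =
    (real_of_int (frobenius_number S) - real (LEAST x. x \<in> generators S \<and> odd x)) / 2"
proof -
  let ?F = "frobenius_number S"
  define x where "x = (LEAST x. x \<in> S \<and> odd x)"
  have gap_iff: "z \<notin> int ` semigroup_quotient S 2 \<longleftrightarrow> ?F - 2 * z \<in> int ` S" for z
    unfolding int_mem_half_iff by (rule symmetric_reflection[OF assms])
  have odd_F: "odd ?F"
    using assms by (rule symmetric_odd_frobenius_number)
  have x_le: "int x \<le> t" if t: "t \<in> int ` S" "odd t" for t
  proof -
    obtain s where "s \<in> S" "odd s" "t = int s"
      using t by auto
    then show ?thesis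
      unfolding x_def by (simp add: Least_le)
  qed
  \<comment> \<open>The gap \<open>-1\<close> of the half reflects to the odd element \<open>F + 2\<close>.\<close>
  have "?F + 2 \<in> int ` S"
    using gap_iff[of "-1"] by auto
  then obtain s where "s \<in> S \<and> odd s"
    using odd_F by (metis even_add even_numeral even_of_nat imageE)
  then have x: "x \<in> S" "odd x"
    unfolding x_def using LeastI[of "\<lambda>x. x \<in> S \<and> odd x"] by auto
  then obtain k where k: "?F - int x = 2 * k"
    using odd_F by (metis dvdE even_diff even_of_nat odd_add add_diff_cancel_right' diff_add_cancel)
  have "frobenius_number (semigroup_quotient S 2) = k"
  proof (rule frobenius_number_equality)
    have "?F - 2 * k = int x"
      using k by simp
    then show "k \<notin> int ` semigroup_quotient S 2"
      using x unfolding gap_iff by simp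
  next
    fix y assume "y \<notin> int ` semigroup_quotient S 2"
    then have "int x \<le> ?F - 2 * y"
      using x_le odd_F unfolding gap_iff by simp
    then show "y \<le> k"
      using k by simp
  qed
  moreover have "real_of_int ?F - real x = 2 * real_of_int k"
    using arg_cong[OF k, of real_of_int] by simp
  ultimately show ?thesis
    unfolding least_odd_generator[OF assms(1)] x_def[symmetric] by simp
qed

end
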